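(* Let $B$ be the ordinal sum of copulas $\{B_k\mid k=1,\ldots,n\}$ with respect to a finite family $\{(a_k,b_k)\mid k=1,\ldots,n\}$ of disjoint open subintervals of $[0,1]$. If $\tfrac12$ does not belong to any of the subintervals $(a_k,b_k)$, then $\beta(B)=1$. If $\tfrac12\in(a_j,b_j)$ for some $j\in\{1,\ldots,n\}$, then $$\beta(B)=4a_j+4(b_j-a_j)\,\delta_{B_j}\Big(\frac{\frac12-a_j}{b_j-a_j}\Big)-1.$$ In particular, if $a_j+b_j=1$ for some $j\in\{1,\ldots,n\}$ (i.e., $\tfrac12$ is the midpoint of $(a_j,b_j)$), then $$\beta(B)=1-(b_j-a_j)(1-\beta(B_j)).$$
   Context: Let $\mathbb{I}=[0,1]$. A (bivariate) copula is a function $C:\mathbb{I}^2\to\mathbb{I}$ with $C(0,v)=C(u,0)=0$, $C(u,1)=u$, $C(1,v)=v$ for all $u,v\in\mathbb{I}$, and $C(u_2,v_2)-C(u_2,v_1)-C(u_1,v_2)+C(u_1,v_1)\ge 0$ whenever $u_1\le u_2$, $v_1\le v_2$ in $\mathbb{I}$. The diagonal of a copula $C$ is $\delta_C(u)=C(u,u)$, $u\in\mathbb{I}$. Given disjoint open subintervals $(a_k,b_k)$ of $\mathbb{I}$ and copulas $B_k$, $k=1,\ldots,n$, the ordinal sum $B$ of $\{B_k\}$ with respect to $\{(a_k,b_k)\}$ is the copula defined by $B(u,v)=a_k+(b_k-a_k)B_k\big(\frac{u-a_k}{b_k-a_k},\frac{v-a_k}{b_k-a_k}\big)$ if $(u,v)\in[a_k,b_k]^2$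 for some $k$, and $B(u,v)=\min\{u,v\}$ otherwise. Blomqvist's beta of a copula $C$ is $\beta(C)=4C(\tfrac12,\tfrac12)-1$. *)

theory Defs
  imports "HOL-Analysis.Analysis"
begin

text \<open>Copulas are total functions on the reals; only their values on the unit square matter.\<close>

definition copula :: "(real \<Rightarrow> real \<Rightarrow> real) \<Rightarrow> bool" where
  "copula C \<longleftrightarrow>
     (\<forall>u\<in>{0..1}. \<forall>v\<in>{0..1}. C u v \<in> {0..1}) \<and>
     (\<forall>v\<in>{0..1}. C 0 v = 0) \<and>
     (\<forall>u\<in>{0..1}. C u 0 = 0) \<and>
     (\<forall>u\<in>{0..1}. C u 1 = u) \<and>
     (\<forall>v\<in>{0..1}. C 1 v = v) \<and>
     (\<forall>u1\<in>{0..1}. \<forall>u2\<in>{0..1}. \<forall>v1\<in>{0..1}. \<forall>v2\<in>{0..1}.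
        u1 \<le> u2 \<longrightarrow> v1 \<le> v2 \<longrightarrow> C u2 v2 - C u2 v1 - C u1 v2 + C u1 v1 \<ge> 0)"

definition diagonal :: "(real \<Rightarrow> real \<Rightarrow> real) \<Rightarrow> real \<Rightarrow> real" where
  "diagonal C u = C u u"

definition blomqvist_beta :: "(real \<Rightarrow> real \<Rightarrow> real) \<Rightarrow> real" where
  "blomqvist_beta C = 4 * C (1/2) (1/2) - 1"

text \<open>
  Disjoint open intervals may share an endpoint, so the square containing a point need not be
  unique; lemma \<open>ordinal_sum_on_square\<close> below shows that the choice of the square is immaterial.
\<close>

definition ordinal_sum ::
  "nat \<Rightarrow> (nat \<Rightarrow> real) \<Rightarrow> (nat \<Rightarrow> real) \<Rightarrow> (nat \<Rightarrow> real \<Rightarrow> real \<Rightarrow> real) \<Rightarrow> real \<Rightarrow> real \<Rightarrow> real" where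
  "ordinal_sum n a b Bs u v =
     (if \<exists>k\<in>{1..n}. u \<in> {a k..b k} \<and> v \<in> {a k..b k} then
        (let k = (SOME k. k \<in> {1..n} \<and> u \<in> {a k..b k} \<and> v \<in> {a k..b k})
         in a k + (b k - a k) * Bs k ((u - a k) / (b k - a k)) ((v - a k) / (b k - a k)))
      else min u v)"

lemma ordinal_sum_on_square:
  assumes bounds: "\<And>k. k \<in> {1..n} \<Longrightarrow> a k < b k"
    and disj: "disjoint_family_on (\<lambda>k. {a k<..<b k}) {1..n}"
    and cop: "\<And>k. k \<in> {1..n} \<Longrightarrow> copula (Bs k)"
    and k: "k \<in> {1..n}" "u \<in> {a k..b k}" "v \<in> {a k..b k}"
  shows "ordinal_sum n a b Bs u v =
           a k + (b k - a k) * Bs k ((u - a k) / (b k - a k)) ((v - a k) / (b k - a k))"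
proof -
  define F where "F k = a k + (b k - a k) * Bs k ((u - a k) / (b k - a k)) ((v - a k) / (b k - a k))" for k
  define l where "l = (SOME k. k \<in> {1..n} \<and> u \<in> {a k..b k} \<and> v \<in> {a k..b k})"
  have l: "l \<in> {1..n} \<and> u \<in> {a l..b l} \<and> v \<in> {a l..b l}"
    unfolding l_def by (rule someI[of _ k]) (use k in blast)
  have eq: "F i = F j"
    if i: "i \<in> {1..n}" "u \<in> {a i..b i}" "v \<in> {a i..b i}"
      and j: "j \<in> {1..n}" "u \<in> {a j..b j}" "v \<in> {a j..b j}" and le: "b i \<le> a j" for i j
  proof -
    have uv: "u = b i" "v = b i" "a j = b i" using i j le by auto
    have "Bs i 1 1 = 1" "Bs j 0 0 = 0" using cop[OF i(1)] cop[OF j(1)] by (auto simp: copula_def)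
    then show ?thesis using uv bounds[OF i(1)] by (simp add: F_def)
  qed
  have "F l = F k"
  proof (cases "l = k")
    case False
    have "b l \<le> a k \<or> b k \<le> a l"
    proof (rule ccontr)
      assume "\<not> ?thesis"
      then have "max (a l) (a k) < min (b l) (b k)" using bounds l k by auto
      then obtain x where "max (a l) (a k) < x" "x < min (b l) (b k)" using dense by blast
      then have "x \<in> {a l<..<b l} \<inter> {a k<..<b k}" by auto
      then show False using disjoint_family_onD[OF disj, of l k] False l k by blast
    qed
    then show ?thesis using eq[of l k] eq[of k l] l k by metis
  qed simp
  moreover have "ordinal_sum n a b Bs u v = F l"
    using k unfolding ordinal_sum_def l_def F_def Let_def by auto
  ultimately show ?thesis by (simp add: F_def)
qed

end

theory Submission
  imports Defs
begin

text \<open>Blomqvist's beta sees only the value at the centre \<open>(1/2, 1/2)\<close>, a point of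
  the main diagonal. If the centre lies in a closed square of the ordinal sum,
  \<open>ordinal_sum_on_square\<close> gives \<open>B\<close> there as a rescaled diagonal value of
  that summand, whichever square the definition picks; otherwise \<open>B\<close> equals
  \<open>min\<close> and the value is 1/2. At a corner of a square the boundary values of a copula
  yield 1/2 again, so beta is 1 as soon as 1/2 avoids the open intervals.\<close>

theorem proposition3p6:
  fixes n :: nat
    and a b :: "nat \<Rightarrow> real"
    and Bs :: "nat \<Rightarrow> real \<Rightarrow> real \<Rightarrow> real"
    and B :: "real \<Rightarrow> real \<Rightarrow> real"
  assumes "\<And>k. k \<in> {1..n} \<Longrightarrow> 0 \<le> a k \<and> a k < b k \<and> b k \<le> 1"
    and "disjoint_family_on (\<lambda>k. {a k<..<b k}) {1..n}"
    and "\<And>k. k \<in> {1..n} \<Longrightarrow> copula (Bs k)"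
    and "B = ordinal_sum n a b Bs"
  shows "((\<forall>k\<in>{1..n}. 1/2 \<notin> {a k<..<b k}) \<longrightarrow> blomqvist_beta B = 1) \<and>
         (\<forall>j\<in>{1..n}. 1/2 \<in> {a j<..<b j} \<longrightarrow>
            blomqvist_beta B =
              4 * a j + 4 * (b j - a j) * diagonal (Bs j) ((1/2 - a j) / (b j - a j)) - 1) \<and>
         (\<forall>j\<in>{1..n}. a j + b j = 1 \<longrightarrow>
            blomqvist_beta B = 1 - (b j - a j) * (1 - blomqvist_beta (Bs j)))"
proof -
  \<comment> \<open>The closed interval is allowed here, so that the formula also covers 1/2 as an
    endpoint.\<close>
  have val: "B (1/2) (1/2) =
      a k + (b k - a k) * Bs k ((1/2 - a k) / (b k - a k)) ((1/2 - a k) / (b k - a k))"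
    if "k \<in> {1..n}" "1/2 \<in> {a k..b k}" for k
    unfolding assms(4) using assms(1-3) that by (intro ordinal_sum_on_square) auto
  have outside: "blomqvist_beta B = 1" if no: "\<forall>k\<in>{1..n}. 1/2 \<notin> {a k<..<b k}"
  \<comment> \<open>The hypothesis excludes 1/2 from open intervals only, while the
    \<open>min\<close> branch requires avoiding the closed ones; the gap is the case of an
    endpoint.\<close>
  proof (cases "\<exists>k\<in>{1..n}. 1/2 \<in> {a k..b k}")
    case True
    then obtain k where k: "k \<in> {1..n}" "1/2 \<in> {a k..b k}" by blast
    have ab: "a k < b k" using assms(1)[OF k(1)] by blast
    have corners: "Bs k 0 0 = 0" "Bs k 1 1 = 1"
      using assms(3)[OF k(1)] by (auto simp: copula_def)
    have "a k = 1/2 \<or> b k = 1/2" using no k by force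
    \<comment> \<open>Rescaling sends the left endpoint to 0 and the right one to 1, where the
      summand takes the values 0 and 1; the formula then returns the endpoint itself.\<close>
    then have "B (1/2) (1/2) = 1/2"
    proof
      assume "a k = 1/2"
      then have "(1/2 - a k) / (b k - a k) = 0" by simp
      then show ?thesis using val[OF k] corners \<open>a k = 1/2\<close> by (simp only:)
    next
      assume "b k = 1/2"
      then have "(1/2 - a k) / (b k - a k) = 1" using ab by simp
      then show ?thesis using val[OF k] corners \<open>b k = 1/2\<close> by (simp only:) simp
    qed
    then show ?thesis by (simp add: blomqvist_beta_def)
  next
    case False
    then have "B (1/2) (1/2) = 1/2" unfolding assms(4) ordinal_sum_def by auto
    then show ?thesis by (simp add: blomqvist_beta_def)
  qed
  have inside: "blomqvist_beta B =
      4 * a j + 4 * (b j - a j) * diagonal (Bs j) ((1/2 - a j) / (b j - a j)) - 1"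
    if "j \<in> {1..n}" "1/2 \<in> {a j<..<b j}" for j
    using val[of j] that by (simp add: blomqvist_beta_def diagonal_def)
  have midpoint: "blomqvist_beta B = 1 - (b j - a j) * (1 - blomqvist_beta (Bs j))"
    if j: "j \<in> {1..n}" and mid: "a j + b j = 1" for j
  proof -
    have ab: "a j < b j" using assms(1)[OF j] by blast
    have "1/2 - a j = (b j - a j) / 2" using mid by (simp add: field_simps)
    then have half: "(1/2 - a j) / (b j - a j) = 1/2" using ab by simp
    have "1/2 \<in> {a j<..<b j}" using ab mid by auto
    from inside[OF j this]
    have "blomqvist_beta B = 4 * a j + 4 * (b j - a j) * diagonal (Bs j) (1/2) - 1"
      by (simp only: half)
    \<comment> \<open>With \<open>b j\<close> eliminated, both sides reduce to
      \<open>2 * a j + (1 - 2 * a j) * blomqvist_beta (Bs j)\<close>.\<close>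
    moreover have bj: "b j = 1 - a j" using mid by simp
    ultimately show ?thesis
      unfolding bj by (simp add: blomqvist_beta_def diagonal_def algebra_simps)
  qed
  show ?thesis using outside inside midpoint by blast
qed

end
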